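(* Let $(\mathbb{X},\|\cdot\|_{\mathbb{X}})$ be a real normed space and let $f:\mathbb{X}\to\mathbb{R}$ be a proper function, finite at $\overline{x}\in\mathbb{X}$. If $f$ is lower Lipschitz at $\overline{x}$, that is, if there exists a constant $L>0$ such that $$f(x)-f(\overline{x})\ge -L\|x-\overline{x}\|\quad\text{for all } x\in\mathbb{X},$$ then $f$ is radially epidifferentiable at $\overline{x}$. If $\mathbb{X}=\mathbb{R}^n$, then this condition is also necessary: if $f$ is radially epidifferentiable at $\overline{x}$, then $f$ is lower Lipschitz at $\overline{x}$.
   Context: For a nonempty subset $A$ of a real normed space and $a\in A$, the closed radial cone is $R(A;a)=\mathrm{cl}(\mathrm{cone}(A-a))$, i.e. the set of all $w$ for which there are $\lambda_n>0$ and $a_n\in A$ with $\lim_{n\to\infty}\lambda_n(a_n-a)=w$. The epigraph of $f$ is $\mathrm{epi}\,f=\{(x,y)\in\mathbb{X}\times\mathbb{R}: f(x)\le y\}$. The radial epiderivative $f^r(\overline{x};\cdot)$ of $f$ at $\overline{x}$ is the function defined by $\mathrm{epi}\,f^r(\overline{x};\cdot)=R(\mathrm{epi}\,f;(\overline{x},f(\overline{x})))$; thus $f^r(\overline{x};h)=\inf\{y\in\mathbb{R}:(h,y)\in R(\mathrm{epi}\,f;(\overline{x},f(\overline{x})))\}$. The function $f$ is called radially epidifferentiable at $\overline{x}$ if $f^r(\overline{x};h)$ exists and is finite for every $h\in\mathbb{X}$. *)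

theory Defs
  imports "HOL-Analysis.Analysis"
begin

definition radial_cone :: "'a::real_normed_vector set \<Rightarrow> 'a \<Rightarrow> 'a set" where
  "radial_cone A a = closure (cone hull ((\<lambda>x. x - a) ` A))"

text \<open>The library's \<open>cone hull\<close> admits the factor 0. For \<open>a \<in> A\<close> this makes no difference,
  and the sequential description of the closed radial cone with positive factors holds.\<close>

lemma radial_cone_sequential:
  assumes "a \<in> A"
  shows "w \<in> radial_cone A a \<longleftrightarrow>
    (\<exists>l u. (\<forall>n::nat. (0::real) < l n \<and> u n \<in> A) \<and> (\<lambda>n. l n *\<^sub>R (u n - a)) \<longlonglongrightarrow> w)"
proof
  assume "w \<in> radial_cone A a"
  then obtain z where z: "\<forall>n. z n \<in> cone hull ((\<lambda>x. x - a) ` A)" and lim: "z \<longlonglongrightarrow> w"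
    unfolding radial_cone_def closure_sequential by blast
  have "\<exists>l u. (0::real) < l \<and> u \<in> A \<and> z n = l *\<^sub>R (u - a)" for n
  proof -
    obtain c x where c: "c \<ge> 0" "x \<in> A" "z n = c *\<^sub>R (x - a)"
      using z unfolding cone_hull_expl by blast
    show ?thesis
    proof (cases "c = 0")
      case True
      then have "z n = 1 *\<^sub>R (a - a)" using c by simp
      then show ?thesis using assms zero_less_one by blast
    next
      case False
      then show ?thesis using c by (metis order_le_less)
    qed
  qed
  then obtain l u where "\<And>n. (0::real) < l n \<and> u n \<in> A \<and> z n = l n *\<^sub>R (u n - a)"
    by metis
  moreover from this have "z = (\<lambda>n. l n *\<^sub>R (u n - a))" by auto
  ultimately show "\<exists>l u. (\<forall>n::nat. (0::real) < l n \<and> u n \<in> A) \<and> (\<lambda>n. l n *\<^sub>R (u n - a)) \<longlonglongrightarrow> w"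
    using lim by blast
next
  assume "\<exists>l u. (\<forall>n::nat. (0::real) < l n \<and> u n \<in> A) \<and> (\<lambda>n. l n *\<^sub>R (u n - a)) \<longlonglongrightarrow> w"
  then obtain l u where lu: "\<forall>n::nat. (0::real) < l n \<and> u n \<in> A"
    and lim: "(\<lambda>n. l n *\<^sub>R (u n - a)) \<longlonglongrightarrow> w" by blast
  have "l n *\<^sub>R (u n - a) \<in> cone hull ((\<lambda>x. x - a) ` A)" for n
    unfolding cone_hull_expl using lu less_imp_le by blast
  then show "w \<in> radial_cone A a"
    unfolding radial_cone_def closure_sequential using lim
    by (intro exI[of _ "\<lambda>n. l n *\<^sub>R (u n - a)"]) simp
qed

text \<open>The function \<open>f\<close> is real-valued, so the library's \<open>epigraph\<close> applies to it. Its radial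
  epiderivative may a priori take infinite values; since its epigraph is still a subset of
  \<open>X \<times> \<real>\<close>, a separate epigraph for extended-real-valued functions is needed.\<close>

definition ereal_epigraph :: "('a \<Rightarrow> ereal) \<Rightarrow> ('a \<times> real) set" where
  "ereal_epigraph g = {(x, y). g x \<le> ereal y}"

definition has_radial_epiderivative ::
  "('a::real_normed_vector \<Rightarrow> real) \<Rightarrow> 'a \<Rightarrow> ('a \<Rightarrow> ereal) \<Rightarrow> bool" where
  "has_radial_epiderivative f a g \<longleftrightarrow>
     ereal_epigraph g = radial_cone (epigraph UNIV f) (a, f a)"

lemma has_radial_epiderivative_eq_Inf:
  assumes "has_radial_epiderivative f a g"
  shows "g h = Inf (ereal ` {y. (h, y) \<in> radial_cone (epigraph UNIV f) (a, f a)})"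
proof -
  have "{y. (h, y) \<in> radial_cone (epigraph UNIV f) (a, f a)} = {y. g h \<le> ereal y}"
    using assms unfolding has_radial_epiderivative_def ereal_epigraph_def by blast
  moreover have "g h = Inf (ereal ` {y. g h \<le> ereal y})"
  proof (rule antisym)
    show "g h \<le> Inf (ereal ` {y. g h \<le> ereal y})"
      by (auto intro: Inf_greatest)
    show "Inf (ereal ` {y. g h \<le> ereal y}) \<le> g h"
    proof (rule ereal_le_real)
      fix z assume "g h \<le> ereal z"
      then show "Inf (ereal ` {y. g h \<le> ereal y}) \<le> ereal z"
        by (auto intro: Inf_lower)
    qed
  qed
  ultimately show ?thesis by simp
qed

definition radially_epidifferentiable ::
  "('a::real_normed_vector \<Rightarrow> real) \<Rightarrow> 'a \<Rightarrow> bool" where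
  "radially_epidifferentiable f a \<longleftrightarrow>
     (\<exists>g. has_radial_epiderivative f a g \<and> (\<forall>h. \<bar>g h\<bar> \<noteq> \<infinity>))"

definition lower_lipschitz_at ::
  "('a::real_normed_vector \<Rightarrow> real) \<Rightarrow> 'a \<Rightarrow> bool" where
  "lower_lipschitz_at f a \<longleftrightarrow> (\<exists>L>0. \<forall>x. f x - f a \<ge> - L * norm (x - a))"

end

(* Write C for the radial cone of the epigraph. Being closed and upward closed in y,
  C is the epigraph of its lower envelope as soon as every vertical slice is nonempty and bounded
  below; the lower Lipschitz inequality passes to C and bounds the slices. Conversely, if no
  constant L works, rescaling points that violate the inequality with L = n shows (0, -1) in C,
  so the slice over 0 is all of the real line and the epiderivative at 0 is -infinity. *)
theory Submission
  imports Defs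
begin

lemma radial_cone_scaleR:
  assumes "w \<in> radial_cone A a" "0 \<le> c"
  shows "c *\<^sub>R w \<in> radial_cone A a"
  using assms cone_closure[OF cone_cone_hull] unfolding radial_cone_def cone_def by blast

lemma diff_mem_radial_cone:
  assumes "x \<in> A"
  shows "x - a \<in> radial_cone A a"
  unfolding radial_cone_def using assms by (intro closure_subset[THEN subsetD] hull_inc) blast

text \<open>This transfers an inequality from the epigraph to its radial cone: it suffices that the
  inequality cuts out a closed cone.\<close>

lemma radial_cone_subset:
  assumes "closed S" "cone S" "\<And>x. x \<in> A \<Longrightarrow> x - a \<in> S"
  shows "radial_cone A a \<subseteq> S"
  unfolding radial_cone_def using assms by (intro closure_minimal hull_minimal) auto

lemma radial_cone_epigraph_upward:
  assumes "(h, y) \<in> radial_cone (epigraph UNIV f) (a, f a)" "y \<le> y'"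
  shows "(h, y') \<in> radial_cone (epigraph UNIV f) (a, f a)"
proof -
  have a: "(a, f a) \<in> epigraph UNIV f"
    by (simp add: epigraph_def)
  obtain l u where lu: "\<And>n::nat. (0::real) < l n \<and> u n \<in> epigraph UNIV f"
    and lim: "(\<lambda>n. l n *\<^sub>R (u n - (a, f a))) \<longlonglongrightarrow> (h, y)"
    using assms(1) unfolding radial_cone_sequential[OF a] by blast
  \<comment> \<open>Raising an epigraph point keeps it in the epigraph. The height is divided by
    \<open>l n\<close> so that after scaling every term is shifted by exactly
    \<open>(0, y' - y)\<close>, and so is the limit.\<close>
  define v where "v n = u n + (0, (y' - y) / l n)" for n
  have "v n \<in> epigraph UNIV f" for n
  proof -
    have "0 \<le> (y' - y) / l n"
      using assms(2) lu[of n] by simp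
    then show ?thesis
      using lu[of n] by (auto simp: v_def epigraph_def)
  qed
  moreover have "l n *\<^sub>R (v n - (a, f a)) = l n *\<^sub>R (u n - (a, f a)) + (0, y' - y)" for n
    using lu[of n] unfolding v_def by (simp add: add_diff_eq diff_add_eq[symmetric] scaleR_add_right)
  then have "(\<lambda>n. l n *\<^sub>R (v n - (a, f a))) \<longlonglongrightarrow> (h, y')"
    using tendsto_add[OF lim tendsto_const[of "(0, y' - y)"]] by simp
  ultimately show ?thesis
    unfolding radial_cone_sequential[OF a] using lu by blast
qed

lemma lower_lipschitz_at_imp_radially_epidifferentiable:
  fixes f :: "'a::real_normed_vector \<Rightarrow> real"
  assumes "lower_lipschitz_at f a"
  shows "radially_epidifferentiable f a"
proof -
  let ?C = "radial_cone (epigraph UNIV f) (a, f a)"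
  obtain L where L: "\<And>x. - L * norm (x - a) \<le> f x - f a"
    using assms unfolding lower_lipschitz_at_def by blast
  \<comment> \<open>\<open>S\<close> is the epigraph of \<open>-L * norm h\<close>, a closed cone
    because this function is continuous and positively homogeneous.\<close>
  define S where "S = {w :: 'a \<times> real. - L * norm (fst w) \<le> snd w}"
  have "closed S"
    unfolding S_def by (intro closed_Collect_le continuous_intros)
  moreover have "cone S"
    unfolding cone_def S_def
  proof clarsimp
    fix w :: 'a and y c :: real
    assume "- (L * norm w) \<le> y" "0 \<le> c"
    then have "c * (- (L * norm w)) \<le> c * y"
      by (rule mult_left_mono)
    then show "- (L * (c * norm w)) \<le> c * y"
      by (simp add: algebra_simps)
  qed
  moreover have "x - (a, f a) \<in> S" if "x \<in> epigraph UNIV f" for x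
    using that L[of "fst x"] by (cases x) (simp add: epigraph_def S_def)
  ultimately have "?C \<subseteq> S"
    by (rule radial_cone_subset)
  then have bound: "- L * norm h \<le> y" if "(h, y) \<in> ?C" for h y
    using that unfolding S_def by auto
  define m where "m h = Inf {y. (h, y) \<in> ?C}" for h
  \<comment> \<open>The graph point over \<open>a + h\<close> puts \<open>f (a + h) - f a\<close>
    into the slice over \<open>h\<close>.\<close>
  have ne: "{y. (h, y) \<in> ?C} \<noteq> {}" for h
    using diff_mem_radial_cone[of "(a + h, f (a + h))" "epigraph UNIV f" "(a, f a)"]
    by (auto simp: epigraph_def)
  have bdd: "bdd_below {y. (h, y) \<in> ?C}" for h
    by (rule bdd_belowI[of _ "- L * norm h"]) (use bound in blast)
  \<comment> \<open>Closedness makes the infimum \<open>m h\<close> attained. With upward closure,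
    the slice is then exactly the half-line from \<open>m h\<close> upward.\<close>
  have "closed {y. (h, y) \<in> ?C}" for h
  proof -
    have "closed ?C"
      by (simp add: radial_cone_def)
    then have "closed (Pair h -` ?C)"
      by (rule closed_vimage) (intro continuous_intros)
    then show ?thesis
      by (simp add: vimage_def)
  qed
  then have m: "(h, m h) \<in> ?C" for h
    using closed_contains_Inf[OF ne bdd] unfolding m_def by blast
  have "(h, y) \<in> ?C \<longleftrightarrow> m h \<le> y" for h y
    using radial_cone_epigraph_upward[OF m] cInf_lower[OF _ bdd] unfolding m_def by blast
  then have "has_radial_epiderivative f a (\<lambda>h. ereal (m h))"
    unfolding has_radial_epiderivative_def ereal_epigraph_def by auto
  then show ?thesis
    unfolding radially_epidifferentiable_def by (intro exI[of _ "\<lambda>h. ereal (m h)"]) simp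
qed

lemma radially_epidifferentiable_imp_lower_lipschitz_at:
  fixes f :: "'a::real_normed_vector \<Rightarrow> real"
  assumes "radially_epidifferentiable f a"
  shows "lower_lipschitz_at f a"
proof (rule ccontr)
  let ?C = "radial_cone (epigraph UNIV f) (a, f a)"
  assume "\<not> lower_lipschitz_at f a"
  then have "\<exists>x. f x - f a < - L * norm (x - a)" if "0 < L" for L
    using that unfolding lower_lipschitz_at_def by (meson not_le)
  \<comment> \<open>\<open>Suc n\<close> keeps the constant positive at \<open>n = 0\<close>
    too.\<close>
  then have "\<exists>x. f x - f a < - real (Suc n) * norm (x - a)" for n
    by (simp del: of_nat_Suc)
  then obtain x where x: "\<And>n. f (x n) - f a < - real (Suc n) * norm (x n - a)"
    by metis
  \<comment> \<open>\<open>d n\<close> is the drop of \<open>f\<close> at \<open>x n\<close>.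
    Dividing by it normalises the vertical component to -1, while the violated inequality forces the
    horizontal one below \<open>1 / Suc n\<close> in norm.\<close>
  define d where "d n = f a - f (x n)" for n
  have d: "real (Suc n) * norm (x n - a) < d n" for n
    using x[of n] by (simp add: d_def del: of_nat_Suc)
  have pos: "0 < d n" for n
    by (rule le_less_trans[OF _ d]) simp
  have mem: "((1 / d n) *\<^sub>R (x n - a), -1) \<in> ?C" for n
  proof -
    have "(1 / d n) *\<^sub>R ((x n, f (x n)) - (a, f a)) \<in> ?C"
      using pos[of n] by (intro radial_cone_scaleR diff_mem_radial_cone) (auto simp: epigraph_def)
    moreover have "(1 / d n) *\<^sub>R ((x n, f (x n)) - (a, f a)) = ((1 / d n) *\<^sub>R (x n - a), -1)"
      using pos[of n] by (simp add: d_def field_simps)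
    ultimately show ?thesis
      by simp
  qed
  have "norm ((1 / d n) *\<^sub>R (x n - a)) \<le> inverse (real (Suc n))" for n
    using d[of n] pos[of n] unfolding norm_scaleR by (simp add: field_simps)
  then have "(\<lambda>n. (1 / d n) *\<^sub>R (x n - a)) \<longlonglongrightarrow> 0"
    by (intro Lim_null_comparison[OF _ LIMSEQ_inverse_real_of_nat] always_eventually allI)
  then have "(\<lambda>n. ((1 / d n) *\<^sub>R (x n - a), -1)) \<longlonglongrightarrow> (0, -1)"
    by (intro tendsto_Pair tendsto_const)
  moreover have "closed ?C"
    by (simp add: radial_cone_def)
  ultimately have "(0, -1) \<in> ?C"
    using mem by (rule closed_sequentially[rotated 2])
  \<comment> \<open>Scaling the single point \<open>(0, -1)\<close> yields arbitrarily low points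
    over 0.\<close>
  then have below: "(0, -c) \<in> ?C" if "0 \<le> c" for c
    using radial_cone_scaleR[OF \<open>(0, -1) \<in> ?C\<close> that] by simp
  obtain g where g: "has_radial_epiderivative f a g" and fin: "\<And>h. \<bar>g h\<bar> \<noteq> \<infinity>"
    using assms unfolding radially_epidifferentiable_def by blast
  obtain r where r: "g 0 = ereal r"
    using fin[of 0] by (metis ereal_real')
  \<comment> \<open>This height lies strictly below \<open>r\<close> whatever the sign of
    \<open>r\<close>, and \<open>\<bar>r\<bar> + 1\<close> is nonnegative as \<open>below\<close>
    demands.\<close>
  have "(0, - (\<bar>r\<bar> + 1)) \<in> ereal_epigraph g"
    using below[of "\<bar>r\<bar> + 1"] g unfolding has_radial_epiderivative_def by simp
  then have "r \<le> - (\<bar>r\<bar> + 1)"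
    unfolding ereal_epigraph_def mem_Collect_eq case_prod_conv r ereal_less_eq .
  then show False
    by linarith
qed

text \<open>Two functions appear because the halves concern different spaces: sufficiency an
  arbitrary normed space, necessity the Euclidean space \<open>real ^ 'n\<close>.\<close>

theorem theorem6:
  fixes f :: "'a::real_normed_vector \<Rightarrow> real" and xbar :: 'a
    and g :: "real ^ 'n \<Rightarrow> real" and zbar :: "real ^ 'n"
  shows "(lower_lipschitz_at f xbar \<longrightarrow> radially_epidifferentiable f xbar)
       \<and> (radially_epidifferentiable g zbar \<longrightarrow> lower_lipschitz_at g zbar)"
  using lower_lipschitz_at_imp_radially_epidifferentiable
    radially_epidifferentiable_imp_lower_lipschitz_at by blast

end
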